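(* The extensionality principle for type 2 functionals, i.e. the sentence $$\forall\Phi^{(\mathbb N\to\mathbb N)\to\mathbb N}\,\forall f^{\mathbb N\to\mathbb N},g^{\mathbb N\to\mathbb N}\,\bigl(\forall n^{\mathbb N}(fn=gn)\to\Phi f=\Phi g\bigr)$$ of the language of $\mathrm{HA}^\omega$, is $\mathcal I^{\mathrm{cp}}$-interpretable.
   Context: $\mathrm{HA}^\omega$ is Heyting arithmetic in all finite types generated by $\sigma\to\tau$ from ground types $\mathbb N$ and $\mathbb B$ (Booleans), with combinators, $0$, successor, recursors, Boolean constants and conditionals; its only relation symbols are logical equalities $\equiv_\sigma$ at each type (the equalities in the claim are $\equiv_{\mathbb N}$). Formulas use $\bot,\wedge,\to,\forall x^\sigma,\exists x^\sigma$. Target language: the language of $\mathrm{HA}^\omega$ with the extra type constructor $\sigma\mapsto\sigma^*$ (non-empty finite subsets) and constants for singleton, union, indexed union $\bigcup_{w\in t}qw$, membership, combinators, conditionals and recursors for all these types, and $\mathrm m:\mathbb N^*\to\mathbb N$ (maximum). $\mathcal S^\omega_*$ is the structure with $\mathcal S_{\mathbb N}=\mathbb N$, $\mathcal S_{\mathbb B}=\{0,1\}$, $\mathcal S_{\rho\to\sigma}$ all functions from $\mathcal S_\rho$ to $\mathcal S_\sigma$, $\mathcal S_{\sigma^*}$ all non-empty finite subsets of $\mathcal S_\sigma$. The target theory $T$ is the set of sentences true in $\mathcal S^\omega_*$. Witnessing types are the types of the target language; witnessing terms are its terms. $\mathcal L^{\mathcal I}$ adds to the language of $\mathrm{HA}^\omega$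 a unary predicate $\mathcal I_\sigma(x^\sigma)$ for each type. Boldface letters are (possibly empty) tuples, $\forall\boldsymbol b\in\boldsymbol B$ is componentwise. $\mathcal I^{\mathrm{cp}}$ (canonical upon precise) is given by: $\langle\mathcal I_{\mathbb N}(x)\rangle^n$ is $x=n$; $\langle\mathcal I_{\mathbb B}(i)\rangle^j$ is $i=j$; and $\langle\mathcal I_{\rho\to\sigma}(h)\rangle^{\boldsymbol f,\boldsymbol g}_{\boldsymbol a,\boldsymbol d}:\equiv\forall x^\rho(\forall\boldsymbol b\in\boldsymbol g\boldsymbol a\boldsymbol d\,\langle\mathcal I_\rho(x)\rangle^{\boldsymbol a}_{\boldsymbol b}\to\langle\mathcal I_\sigma(hx)\rangle^{\boldsymbol f\boldsymbol a}_{\boldsymbol d})$. In particular, $\langle\mathcal I_{\mathbb N\to\mathbb N}(f)\rangle^g_k$ is $fk=gk$ and $\langle\mathcal I_{(\mathbb N\to\mathbb N)\to\mathbb N}(\Phi)\rangle^{\Psi,\mu}_h$ is $\forall f(\forall k\in\mu h(fk=hk)\to\Phi f=\Psi h)$, with $\mu:(\mathbb N\to\mathbb N)\to\mathbb N^*$, $\Psi:(\mathbb N\to\mathbb N)\to\mathbb N$. $\mathcal U$-interpretation of formulas of $\mathcal L^{\mathcal I}$: $\langle x\equiv_\sigma y\rangle$ is $x=y$; $\langle\bot\rangle:\equiv\bot$; $\langle A\wedge B\rangle^{\boldsymbol a,\boldsymbol c}_{\boldsymbol b,\boldsymbol d}:\equiv\langle A\rangle^{\boldsymbol a}_{\boldsymbol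 b}\wedge\langle B\rangle^{\boldsymbol c}_{\boldsymbol d}$; $\langle A\to B\rangle^{\boldsymbol f,\boldsymbol g}_{\boldsymbol a,\boldsymbol d}:\equiv\forall\boldsymbol b\in\boldsymbol g\boldsymbol a\boldsymbol d\,\langle A\rangle^{\boldsymbol a}_{\boldsymbol b}\to\langle B\rangle^{\boldsymbol f\boldsymbol a}_{\boldsymbol d}$; $\langle\forall xA\rangle^{\boldsymbol a}_{\boldsymbol b}:\equiv\forall x\langle A\rangle^{\boldsymbol a}_{\boldsymbol b}$; $\langle\exists xA\rangle^{\boldsymbol a}_{\boldsymbol B}:\equiv\exists x\forall\boldsymbol b\in\boldsymbol B\langle A\rangle^{\boldsymbol a}_{\boldsymbol b}$. $A$ is $\mathcal U$-interpretable if there are closed witnessing terms $\boldsymbol t$ with $T\vdash\forall\boldsymbol b\langle A\rangle^{\boldsymbol t}_{\boldsymbol b}$. $A^{\mathcal I}$ replaces $\forall x^\sigma(\dots)$ by $\forall x^\sigma(\mathcal I_\sigma(x)\to\dots)$ and $\exists x^\sigma(\dots)$ by $\exists x^\sigma(\mathcal I_\sigma(x)\wedge\dots)$. A sentence $A$ of $\mathrm{HA}^\omega$ is $\mathcal I^{\mathrm{cp}}$-interpretable if $A^{\mathcal I}$ is $\mathcal U$-interpretable when the atomic formulas $\mathcal I_\sigma(x)$ are interpreted by the clauses of $\mathcal I^{\mathrm{cp}}$ (that is, $x=n$ at type $\mathbb N$, $i=j$ at type $\mathbb B$, and the stated canonical clause for $\langle\mathcal I_{\rho\to\sigma}(h)\rangle^{\boldsymbol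 f,\boldsymbol g}_{\boldsymbol a,\boldsymbol d}$ at function types) and $x\equiv_\sigma y$ is interpreted as $x=y$. *)

theory Defs
  imports "HOL-Library.FuncSet"
begin

section \<open>Types and terms of the target language\<close>

text \<open>The types of HA\<open>\<^sup>\<omega>\<close> are those without \<open>Star\<close>;
  \<open>Star \<sigma>\<close> is the type of non-empty finite subsets of type \<open>\<sigma>\<close>.\<close>

datatype ty = Nat | Bool | Fun ty ty (infixr "\<rightarrow>\<^sub>t" 60) | Star ty

datatype cst =
    KC ty ty
  | SC ty ty ty
  | Zero
  | Succ
  | Rec ty
  | TT
  | FF
  | Cond ty
  | Sing ty
  | Union ty
  | BigUnion ty ty
  | Mem ty
  | MaxN

fun cty :: "cst \<Rightarrow> ty" where
  "cty (KC \<rho> \<sigma>) = \<rho> \<rightarrow>\<^sub>t \<sigma> \<rightarrow>\<^sub>t \<rho>"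
| "cty (SC \<rho> \<sigma> \<tau>) = (\<rho> \<rightarrow>\<^sub>t \<sigma> \<rightarrow>\<^sub>t \<tau>) \<rightarrow>\<^sub>t (\<rho> \<rightarrow>\<^sub>t \<sigma>) \<rightarrow>\<^sub>t \<rho> \<rightarrow>\<^sub>t \<tau>"
| "cty Zero = Nat"
| "cty Succ = Nat \<rightarrow>\<^sub>t Nat"
| "cty (Rec \<sigma>) = \<sigma> \<rightarrow>\<^sub>t (Nat \<rightarrow>\<^sub>t \<sigma> \<rightarrow>\<^sub>t \<sigma>) \<rightarrow>\<^sub>t Nat \<rightarrow>\<^sub>t \<sigma>"
| "cty TT = Bool"
| "cty FF = Bool"
| "cty (Cond \<sigma>) = Bool \<rightarrow>\<^sub>t \<sigma> \<rightarrow>\<^sub>t \<sigma> \<rightarrow>\<^sub>t \<sigma>"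
| "cty (Sing \<sigma>) = \<sigma> \<rightarrow>\<^sub>t Star \<sigma>"
| "cty (Union \<sigma>) = Star \<sigma> \<rightarrow>\<^sub>t Star \<sigma> \<rightarrow>\<^sub>t Star \<sigma>"
| "cty (BigUnion \<rho> \<sigma>) = Star \<rho> \<rightarrow>\<^sub>t (\<rho> \<rightarrow>\<^sub>t Star \<sigma>) \<rightarrow>\<^sub>t Star \<sigma>"
| "cty (Mem \<sigma>) = \<sigma> \<rightarrow>\<^sub>t Star \<sigma> \<rightarrow>\<^sub>t Bool"
| "cty MaxN = Star Nat \<rightarrow>\<^sub>t Nat"

text \<open>Variables are de Bruijn indices; a typing context lists the types of
  indices \<open>0, 1, \<dots>\<close>, innermost binder first.\<close>

datatype trm = Var nat | Cst cst | App trm trm (infixl "\<cdot>" 200)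

fun tyof :: "ty list \<Rightarrow> trm \<Rightarrow> ty option" where
  "tyof \<Gamma> (Var i) = (if i < length \<Gamma> then Some (\<Gamma> ! i) else None)"
| "tyof \<Gamma> (Cst c) = Some (cty c)"
| "tyof \<Gamma> (s \<cdot> t) = (case tyof \<Gamma> s of
      Some (\<rho> \<rightarrow>\<^sub>t \<sigma>) \<Rightarrow> if tyof \<Gamma> t = Some \<rho> then Some \<sigma> else None
    | _ \<Rightarrow> None)"

definition apps :: "trm \<Rightarrow> trm list \<Rightarrow> trm" where
  "apps t as = foldl App t as"

text \<open>\<open>lift d c t\<close> adds \<open>d\<close> to every index of \<open>t\<close> that is at least \<open>c\<close>.\<close>

fun lift :: "nat \<Rightarrow> nat \<Rightarrow> trm \<Rightarrow> trm" where
  "lift d c (Var i) = Var (if i < c then i else i + d)"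
| "lift d c (Cst k) = Cst k"
| "lift d c (s \<cdot> t) = lift d c s \<cdot> lift d c t"


section \<open>Formulas of the target language and of HA\<open>\<^sup>\<omega>\<close>\<close>

datatype fm =
    Eq ty trm trm
  | Bot
  | And fm fm
  | Imp fm fm
  | All ty fm
  | Ex ty fm

fun wf_fm :: "ty list \<Rightarrow> fm \<Rightarrow> bool" where
  "wf_fm \<Gamma> (Eq \<sigma> s t) \<longleftrightarrow> tyof \<Gamma> s = Some \<sigma> \<and> tyof \<Gamma> t = Some \<sigma>"
| "wf_fm \<Gamma> Bot \<longleftrightarrow> True"
| "wf_fm \<Gamma> (And A B) \<longleftrightarrow> wf_fm \<Gamma> A \<and> wf_fm \<Gamma> B"
| "wf_fm \<Gamma> (Imp A B) \<longleftrightarrow> wf_fm \<Gamma> A \<and> wf_fm \<Gamma> B"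
| "wf_fm \<Gamma> (All \<sigma> A) \<longleftrightarrow> wf_fm (\<sigma> # \<Gamma>) A"
| "wf_fm \<Gamma> (Ex \<sigma> A) \<longleftrightarrow> wf_fm (\<sigma> # \<Gamma>) A"

fun types_trm :: "trm \<Rightarrow> ty set" where
  "types_trm (Var i) = {}"
| "types_trm (Cst c) = {cty c}"
| "types_trm (s \<cdot> t) = types_trm s \<union> types_trm t"

fun types_fm :: "fm \<Rightarrow> ty set" where
  "types_fm (Eq \<sigma> s t) = {\<sigma>} \<union> types_trm s \<union> types_trm t"
| "types_fm Bot = {}"
| "types_fm (And A B) = types_fm A \<union> types_fm B"
| "types_fm (Imp A B) = types_fm A \<union> types_fm B"
| "types_fm (All \<sigma> A) = {\<sigma>} \<union> types_fm A"
| "types_fm (Ex \<sigma> A) = {\<sigma>} \<union> types_fm A"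

fun star_free :: "ty \<Rightarrow> bool" where
  "star_free Nat \<longleftrightarrow> True"
| "star_free Bool \<longleftrightarrow> True"
| "star_free (\<rho> \<rightarrow>\<^sub>t \<sigma>) \<longleftrightarrow> star_free \<rho> \<and> star_free \<sigma>"
| "star_free (Star \<sigma>) \<longleftrightarrow> False"

text \<open>The type of every constant that does not belong to HA\<open>\<^sup>\<omega>\<close> contains \<open>Star\<close>, so
  star-freeness of all types occurring in a formula also excludes those constants.\<close>

definition HA_sentence :: "fm \<Rightarrow> bool" where
  "HA_sentence A \<longleftrightarrow> wf_fm [] A \<and> (\<forall>\<sigma>\<in>types_fm A. star_free \<sigma>)"


section \<open>The structure of all set-theoretic functionals\<close>

text \<open>No single HOL type can be shown to contain the full type structure over all finite
  types at once: it has cardinality \<open>beth\<^sub>\<omega>\<close>, and the set of all sentences true in it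
  is not definable in HOL.  The structure is therefore described, up to isomorphism, inside an
  arbitrary type \<open>'u\<close> and on those types that occur in the sentence under consideration.  In a structure, \<open>app\<close> decodes an element
  of \<open>car (\<rho> \<rightarrow>\<^sub>t \<sigma>)\<close> to a function and \<open>elts\<close> decodes an element of
  \<open>car (Star \<sigma>)\<close> to a finite set; being standard at a type means that this decoding is a
  bijection with the intended set.\<close>

record 'u struct =
  car :: "ty \<Rightarrow> 'u set"
  natv :: "nat \<Rightarrow> 'u"
  boolv :: "bool \<Rightarrow> 'u"
  app :: "'u \<Rightarrow> 'u \<Rightarrow> 'u"
  elts :: "'u \<Rightarrow> 'u set"

fun standard_at :: "'u struct \<Rightarrow> ty \<Rightarrow> bool" where
  "standard_at M Nat \<longleftrightarrow> bij_betw (natv M) UNIV (car M Nat)"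
| "standard_at M Bool \<longleftrightarrow> bij_betw (boolv M) UNIV (car M Bool)"
| "standard_at M (\<rho> \<rightarrow>\<^sub>t \<sigma>) \<longleftrightarrow> standard_at M \<rho> \<and> standard_at M \<sigma> \<and>
     bij_betw (\<lambda>f. restrict (app M f) (car M \<rho>)) (car M (\<rho> \<rightarrow>\<^sub>t \<sigma>)) (car M \<rho> \<rightarrow>\<^sub>E car M \<sigma>)"
| "standard_at M (Star \<sigma>) \<longleftrightarrow> standard_at M \<sigma> \<and>
     bij_betw (elts M) (car M (Star \<sigma>)) {X. X \<subseteq> car M \<sigma> \<and> finite X \<and> X \<noteq> {}}"

definition standard :: "ty set \<Rightarrow> 'u struct \<Rightarrow> bool" where
  "standard F M \<longleftrightarrow> (\<forall>\<sigma>\<in>F. standard_at M \<sigma>)"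

definition lam :: "'u struct \<Rightarrow> ty \<Rightarrow> ty \<Rightarrow> ('u \<Rightarrow> 'u) \<Rightarrow> 'u" where
  "lam M \<rho> \<sigma> f = the_inv_into (car M (\<rho> \<rightarrow>\<^sub>t \<sigma>)) (\<lambda>g. restrict (app M g) (car M \<rho>))
     (restrict f (car M \<rho>))"

definition mkset :: "'u struct \<Rightarrow> ty \<Rightarrow> 'u set \<Rightarrow> 'u" where
  "mkset M \<sigma> X = the_inv_into (car M (Star \<sigma>)) (elts M) X"

definition nat_of :: "'u struct \<Rightarrow> 'u \<Rightarrow> nat" where
  "nat_of M x = the_inv_into UNIV (natv M) x"

fun den :: "'u struct \<Rightarrow> cst \<Rightarrow> 'u" where
  "den M (KC \<rho> \<sigma>) = lam M \<rho> (\<sigma> \<rightarrow>\<^sub>t \<rho>) (\<lambda>x. lam M \<sigma> \<rho> (\<lambda>y. x))"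
| "den M (SC \<rho> \<sigma> \<tau>) = lam M (\<rho> \<rightarrow>\<^sub>t \<sigma> \<rightarrow>\<^sub>t \<tau>) ((\<rho> \<rightarrow>\<^sub>t \<sigma>) \<rightarrow>\<^sub>t \<rho> \<rightarrow>\<^sub>t \<tau>)
     (\<lambda>x. lam M (\<rho> \<rightarrow>\<^sub>t \<sigma>) (\<rho> \<rightarrow>\<^sub>t \<tau>) (\<lambda>y. lam M \<rho> \<tau> (\<lambda>z. app M (app M x z) (app M y z))))"
| "den M Zero = natv M 0"
| "den M Succ = lam M Nat Nat (\<lambda>n. natv M (Suc (nat_of M n)))"
| "den M (Rec \<sigma>) = lam M \<sigma> ((Nat \<rightarrow>\<^sub>t \<sigma> \<rightarrow>\<^sub>t \<sigma>) \<rightarrow>\<^sub>t Nat \<rightarrow>\<^sub>t \<sigma>)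
     (\<lambda>x. lam M (Nat \<rightarrow>\<^sub>t \<sigma> \<rightarrow>\<^sub>t \<sigma>) (Nat \<rightarrow>\<^sub>t \<sigma>)
       (\<lambda>y. lam M Nat \<sigma> (\<lambda>n. rec_nat x (\<lambda>k r. app M (app M y (natv M k)) r) (nat_of M n))))"
| "den M TT = boolv M True"
| "den M FF = boolv M False"
| "den M (Cond \<sigma>) = lam M Bool (\<sigma> \<rightarrow>\<^sub>t \<sigma> \<rightarrow>\<^sub>t \<sigma>) (\<lambda>b. lam M \<sigma> (\<sigma> \<rightarrow>\<^sub>t \<sigma>)
     (\<lambda>x. lam M \<sigma> \<sigma> (\<lambda>y. if b = boolv M True then x else y)))"
| "den M (Sing \<sigma>) = lam M \<sigma> (Star \<sigma>) (\<lambda>x. mkset M \<sigma> {x})"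
| "den M (Union \<sigma>) = lam M (Star \<sigma>) (Star \<sigma> \<rightarrow>\<^sub>t Star \<sigma>)
     (\<lambda>X. lam M (Star \<sigma>) (Star \<sigma>) (\<lambda>Y. mkset M \<sigma> (elts M X \<union> elts M Y)))"
| "den M (BigUnion \<rho> \<sigma>) = lam M (Star \<rho>) ((\<rho> \<rightarrow>\<^sub>t Star \<sigma>) \<rightarrow>\<^sub>t Star \<sigma>)
     (\<lambda>X. lam M (\<rho> \<rightarrow>\<^sub>t Star \<sigma>) (Star \<sigma>) (\<lambda>q. mkset M \<sigma> (\<Union>w\<in>elts M X. elts M (app M q w))))"
| "den M (Mem \<sigma>) = lam M \<sigma> (Star \<sigma> \<rightarrow>\<^sub>t Bool)
     (\<lambda>x. lam M (Star \<sigma>) Bool (\<lambda>X. boolv M (x \<in> elts M X)))"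
| "den M MaxN = lam M (Star Nat) Nat (\<lambda>X. natv M (Max (nat_of M ` elts M X)))"

fun eval :: "'u struct \<Rightarrow> 'u list \<Rightarrow> trm \<Rightarrow> 'u" where
  "eval M e (Var i) = e ! i"
| "eval M e (Cst c) = den M c"
| "eval M e (s \<cdot> t) = app M (eval M e s) (eval M e t)"

fun sat :: "'u struct \<Rightarrow> 'u list \<Rightarrow> fm \<Rightarrow> bool" where
  "sat M e (Eq \<sigma> s t) \<longleftrightarrow> eval M e s = eval M e t"
| "sat M e Bot \<longleftrightarrow> False"
| "sat M e (And A B) \<longleftrightarrow> sat M e A \<and> sat M e B"
| "sat M e (Imp A B) \<longleftrightarrow> (sat M e A \<longrightarrow> sat M e B)"
| "sat M e (All \<sigma> A) \<longleftrightarrow> (\<forall>x\<in>car M \<sigma>. sat M (x # e) A)"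
| "sat M e (Ex \<sigma> A) \<longleftrightarrow> (\<exists>x\<in>car M \<sigma>. sat M (x # e) A)"

text \<open>The sentences true in the full structure whose types can be realised inside \<open>'u\<close>.
  Structures that are standard on the same types are isomorphic on them, so it is immaterial
  which one is used; the second conjunct excludes sentences about types too large for \<open>'u\<close>,
  for which the third conjunct would be void.  Hence every member is true in the full structure,
  a larger \<open>'u\<close> gives more members, and a \<open>'u\<close> that is large enough for all types gives
  all true sentences.  As the set of true sentences is deductively closed, provability from
  it is membership.\<close>

definition true_sentences :: "'u itself \<Rightarrow> fm set" where
  "true_sentences U = {A. wf_fm [] A \<and> (\<exists>M :: 'u struct. standard (types_fm A) M) \<and>
     (\<forall>M :: 'u struct. standard (types_fm A) M \<longrightarrow> sat M [] A)}"


section \<open>Formulas with the predicates \<open>\<I>\<^sub>\<sigma>\<close>\<close>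

datatype ifm =
    IEq ty trm trm
  | IPred ty trm
  | IBot
  | IAnd ifm ifm
  | IImp ifm ifm
  | IAll ty ifm
  | IEx ty ifm

fun relativize :: "fm \<Rightarrow> ifm" where
  "relativize (Eq \<sigma> s t) = IEq \<sigma> s t"
| "relativize Bot = IBot"
| "relativize (And A B) = IAnd (relativize A) (relativize B)"
| "relativize (Imp A B) = IImp (relativize A) (relativize B)"
| "relativize (All \<sigma> A) = IAll \<sigma> (IImp (IPred \<sigma> (Var 0)) (relativize A))"
| "relativize (Ex \<sigma> A) = IEx \<sigma> (IAnd (IPred \<sigma> (Var 0)) (relativize A))"

fun lift_ifm :: "nat \<Rightarrow> nat \<Rightarrow> ifm \<Rightarrow> ifm" where
  "lift_ifm d c (IEq \<sigma> s t) = IEq \<sigma> (lift d c s) (lift d c t)"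
| "lift_ifm d c (IPred \<sigma> t) = IPred \<sigma> (lift d c t)"
| "lift_ifm d c IBot = IBot"
| "lift_ifm d c (IAnd A B) = IAnd (lift_ifm d c A) (lift_ifm d c B)"
| "lift_ifm d c (IImp A B) = IImp (lift_ifm d c A) (lift_ifm d c B)"
| "lift_ifm d c (IAll \<sigma> A) = IAll \<sigma> (lift_ifm d (Suc c) A)"
| "lift_ifm d c (IEx \<sigma> A) = IEx \<sigma> (lift_ifm d (Suc c) A)"

fun depth :: "ifm \<Rightarrow> nat" where
  "depth (IEq \<sigma> s t) = 0"
| "depth (IPred \<sigma> t) = 0"
| "depth IBot = 0"
| "depth (IAnd A B) = Suc (max (depth A) (depth B))"
| "depth (IImp A B) = Suc (max (depth A) (depth B))"
| "depth (IAll \<sigma> A) = Suc (depth A)"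
| "depth (IEx \<sigma> A) = Suc (depth A)"

lemma depth_lift_ifm [simp]: "depth (lift_ifm d c A) = depth A"
  by (induction A arbitrary: c) auto


section \<open>The interpretation\<close>

text \<open>\<open>upI\<close>, \<open>up\<close> give the types of the upper tuple and \<open>dnI\<close>, \<open>dn\<close> those of the lower
  tuple of an interpreted formula.  In the interpretation the terms of these tuples live in the
  same context as the formula itself, whence the lifting under each binder.  The clauses for
  \<open>\<I>\<^sub>\<sigma>\<close> are only given for star-free \<open>\<sigma>\<close>.\<close>

definition funty :: "ty list \<Rightarrow> ty \<Rightarrow> ty" where
  "funty \<sigma>s \<tau> = foldr Fun \<sigma>s \<tau>"

fun upI :: "ty \<Rightarrow> ty list" and dnI :: "ty \<Rightarrow> ty list" where
  "upI Nat = [Nat]"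
| "upI Bool = [Bool]"
| "upI (\<rho> \<rightarrow>\<^sub>t \<sigma>) = map (funty (upI \<rho>)) (upI \<sigma>)
     @ map (\<lambda>\<beta>. funty (upI \<rho> @ dnI \<sigma>) (Star \<beta>)) (dnI \<rho>)"
| "dnI Nat = []"
| "dnI Bool = []"
| "dnI (\<rho> \<rightarrow>\<^sub>t \<sigma>) = upI \<rho> @ dnI \<sigma>"

fun up :: "ifm \<Rightarrow> ty list" and dn :: "ifm \<Rightarrow> ty list" where
  "up (IEq \<sigma> s t) = []"
| "up (IPred \<sigma> t) = upI \<sigma>"
| "up IBot = []"
| "up (IAnd A B) = up A @ up B"
| "up (IImp A B) = map (funty (up A)) (up B)
     @ map (\<lambda>\<beta>. funty (up A @ dn B) (Star \<beta>)) (dn A)"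
| "up (IAll \<sigma> A) = up A"
| "up (IEx \<sigma> A) = up A"
| "dn (IEq \<sigma> s t) = []"
| "dn (IPred \<sigma> t) = dnI \<sigma>"
| "dn IBot = []"
| "dn (IAnd A B) = dn A @ dn B"
| "dn (IImp A B) = up A @ dn B"
| "dn (IAll \<sigma> A) = dn A"
| "dn (IEx \<sigma> A) = map Star (dn A)"

text \<open>\<open>ball \<beta>s Bs A\<close> is \<open>\<forall>b\<^sub>1\<in>B\<^sub>1. \<dots> \<forall>b\<^sub>m\<in>B\<^sub>m. A\<close>, where \<open>Bs\<close> are terms of the outer
  context and \<open>A\<close> lives in the context extended by all of \<open>b\<^sub>1, \<dots>, b\<^sub>m\<close>; in that
  context \<open>vars m\<close> is the tuple \<open>b\<^sub>1, \<dots>, b\<^sub>m\<close>.\<close>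

fun ball :: "ty list \<Rightarrow> trm list \<Rightarrow> fm \<Rightarrow> fm" where
  "ball (\<beta> # \<beta>s) (B # Bs) A = All \<beta> (Imp (Eq Bool (Cst (Mem \<beta>) \<cdot> Var 0 \<cdot> lift 1 0 B) (Cst TT))
     (ball \<beta>s (map (lift 1 0) Bs) A))"
| "ball _ _ A = A"

definition vars :: "nat \<Rightarrow> trm list" where
  "vars m = map Var (rev [0..<m])"

fun interpI :: "ty \<Rightarrow> trm \<Rightarrow> trm list \<Rightarrow> trm list \<Rightarrow> fm" where
  "interpI Nat x us vs = Eq Nat x (hd us)"
| "interpI Bool x us vs = Eq Bool x (hd us)"
| "interpI (\<rho> \<rightarrow>\<^sub>t \<sigma>) h us vs =
    (let fs = take (length (upI \<sigma>)) us; gs = drop (length (upI \<sigma>)) us;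
         as = take (length (upI \<rho>)) vs; ds = drop (length (upI \<rho>)) vs;
         m = length (dnI \<rho>)
     in All \<rho> (Imp
          (ball (dnI \<rho>) (map (\<lambda>g. lift 1 0 (apps g (as @ ds))) gs)
             (interpI \<rho> (Var m) (map (lift (Suc m) 0) as) (vars m)))
          (interpI \<sigma> (lift 1 0 h \<cdot> Var 0)
             (map (\<lambda>f. lift 1 0 (apps f as)) fs) (map (lift 1 0) ds))))"

function interp :: "ifm \<Rightarrow> trm list \<Rightarrow> trm list \<Rightarrow> fm" where
  "interp (IEq \<sigma> s t) us vs = Eq \<sigma> s t"
| "interp (IPred \<sigma> t) us vs = interpI \<sigma> t us vs"
| "interp IBot us vs = Bot"
| "interp (IAnd A B) us vs =
     And (interp A (take (length (up A)) us) (take (length (dn A)) vs))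
         (interp B (drop (length (up A)) us) (drop (length (dn A)) vs))"
| "interp (IImp A B) us vs =
    (let fs = take (length (up B)) us; gs = drop (length (up B)) us;
         as = take (length (up A)) vs; ds = drop (length (up A)) vs;
         m = length (dn A)
     in Imp
          (ball (dn A) (map (\<lambda>g. apps g (as @ ds)) gs)
             (interp (lift_ifm m 0 A) (map (lift m 0) as) (vars m)))
          (interp B (map (\<lambda>f. apps f as) fs) ds))"
| "interp (IAll \<sigma> A) us vs = All \<sigma> (interp A (map (lift 1 0) us) (map (lift 1 0) vs))"
| "interp (IEx \<sigma> A) us vs =
    (let m = length (dn A)
     in Ex \<sigma> (ball (dn A) (map (lift 1 0) vs)
          (interp (lift_ifm m 0 A) (map (lift (Suc m) 0) us) (vars m))))"
  by pat_completeness auto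
termination
  by (relation "measure (\<lambda>(A, us, vs). depth A)") auto

text \<open>For a sentence \<open>A\<close> and closed terms no lifting is needed under the outer quantifiers.\<close>

definition U_interpretable :: "'u itself \<Rightarrow> ifm \<Rightarrow> bool" where
  "U_interpretable U A \<longleftrightarrow> (\<exists>ts. map (tyof []) ts = map Some (up A) \<and>
     foldr All (dn A) (interp A ts (vars (length (dn A)))) \<in> true_sentences U)"

definition Icp_interpretable :: "'u itself \<Rightarrow> fm \<Rightarrow> bool" where
  "Icp_interpretable U A \<longleftrightarrow> HA_sentence A \<and> U_interpretable U (relativize A)"


section \<open>Extensionality for type 2 functionals\<close>

definition ext2 :: fm where
  "ext2 = All ((Nat \<rightarrow>\<^sub>t Nat) \<rightarrow>\<^sub>t Nat) (All (Nat \<rightarrow>\<^sub>t Nat) (All (Nat \<rightarrow>\<^sub>t Nat)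
     (let \<Phi> = Var 2; f = Var 1; g = Var 0
      in Imp (All Nat (Eq Nat (lift 1 0 f \<cdot> Var 0) (lift 1 0 g \<cdot> Var 0)))
             (Eq Nat (\<Phi> \<cdot> f) (\<Phi> \<cdot> g)))))"

end

theory Submission
  imports Defs "HOL-Library.Countable" "HOL-Library.Equipollence"
begin

text \<open>Upper data for the hypothesis \<open>\<I>(\<Phi>)\<close> are a functional \<open>\<Psi>\<close> and a modulus \<open>\<mu>\<close> such
  that \<open>\<Phi> f = \<Psi> h\<close> whenever \<open>f\<close> agrees with \<open>h\<close> on \<open>\<mu> h\<close>; upper data for \<open>\<I>(f)\<close> and
  \<open>\<I>(g)\<close> are functions \<open>f'\<close> and \<open>g'\<close>. It suffices to challenge \<open>\<Phi>\<close> at the single point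
  \<open>h = f'\<close> and every other premise on the finite set \<open>\<mu> f'\<close>: there \<open>f = f'\<close> and \<open>f = g\<close>, so
  both \<open>f\<close> and \<open>g\<close> agree with \<open>f'\<close> on \<open>\<mu> f'\<close> and \<open>\<Phi> f = \<Psi> f' = \<Phi> g\<close>. The realizers are
  therefore \<open>\<lambda>\<Psi> \<mu> f' g'. \<mu> f'\<close> and \<open>\<lambda>\<Psi> \<mu> f' g'. {f'}\<close>. That a structure standard at all types
  in question fits into \<open>'u\<close> is a cardinality argument: each of these types has at most
  \<open>beth\<^sub>5\<close> elements.\<close>

section \<open>A chain of power sets\<close>

lemma eqpoll_Pow_cong: "A \<approx> B \<Longrightarrow> Pow A \<approx> Pow B"
  unfolding eqpoll_def using bij_betw_Pow by blast

lemma lepoll_Pow_mono: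
  assumes "A \<lesssim> B"
  shows "Pow A \<lesssim> Pow B"
proof -
  obtain f where "inj_on f A" "f ` A \<subseteq> B"
    using assms by (auto simp: lepoll_def)
  then have "inj_on (image f) (Pow A)" "image f ` Pow A \<subseteq> Pow B"
    by (blast intro: inj_on_image_Pow)+
  then show ?thesis
    unfolding lepoll_def by blast
qed

text \<open>A function whose values are coded as subsets of \<open>C\<close> is recovered from the
  relation \<open>c \<in> e (f x)\<close> between \<open>A\<close> and \<open>C\<close>, since
  extensional functions are determined by their values on \<open>A\<close>.\<close>

lemma funcset_lepoll_Pow_Times:
  assumes "B \<lesssim> Pow C"
  shows "(A \<rightarrow>\<^sub>E B) \<lesssim> Pow (A \<times> C)"
proof -
  obtain e where e: "inj_on e B" "e ` B \<subseteq> Pow C"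
    using assms by (auto simp: lepoll_def)
  define G where "G f = {(x, c). x \<in> A \<and> c \<in> e (f x)}" for f
  have "f x = g x" if "f \<in> A \<rightarrow>\<^sub>E B" "g \<in> A \<rightarrow>\<^sub>E B" "G f = G g" "x \<in> A" for f g x
  proof -
    have "e (f x) = e (g x)"
      using that(3,4) by (auto simp: G_def set_eq_iff)
    then show ?thesis
      using e(1) that by (auto dest: inj_onD)
  qed
  then have "inj_on G (A \<rightarrow>\<^sub>E B)"
    by (intro inj_onI PiE_ext)
  moreover have "G ` (A \<rightarrow>\<^sub>E B) \<subseteq> Pow (A \<times> C)"
    using e(2) by (auto simp: G_def)
  ultimately show ?thesis
    unfolding lepoll_def by blast
qed

lemma times_lepoll_infinite:
  assumes "infinite B" "A \<lesssim> B" "A' \<lesssim> B"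
  shows "A \<times> A' \<lesssim> B"
proof -
  have "B \<times> B \<approx> B"
    using card_of_Times_same_infinite[OF assms(1)] by (simp add: eqpoll_iff_card_of_ordIso)
  then show ?thesis
    using times_lepoll_mono[OF assms(2,3)] lepoll_trans2 by blast
qed

text \<open>The levels are power sets only up to equipollence, so that all of them can live in a
  single type.\<close>

definition beth_chain :: "nat \<Rightarrow> (nat \<Rightarrow> 'a set) \<Rightarrow> bool" where
  "beth_chain n B \<longleftrightarrow> infinite (B 0) \<and> (\<forall>k<n. Pow (B k) \<approx> B (Suc k))"

lemma beth_chain_mono:
  assumes "beth_chain n B" "i \<le> k" "k \<le> n"
  shows "B i \<lesssim> B k"
  using assms(2,3)
proof (induction k rule: dec_induct)
  case (step k)
  then have "Pow (B k) \<approx> B (Suc k)"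
    using assms(1) by (auto simp: beth_chain_def)
  then show ?case
    using step by (meson Suc_leD lepoll_Pow_self lepoll_trans lepoll_trans2)
qed simp

lemma beth_chain_infinite:
  assumes "beth_chain n B" "k \<le> n"
  shows "infinite (B k)"
  using beth_chain_mono[OF assms(1) le0 assms(2)] assms(1) infinite_le_lepoll lepoll_trans
  unfolding beth_chain_def by metis

lemma beth_chain_image:
  assumes "beth_chain n B" "inj f"
  shows "beth_chain n (\<lambda>k. f ` B k)"
proof -
  have e: "f ` X \<approx> X" for X
    using assms(2) by (meson inj_on_image_eqpoll_self inj_on_subset subset_UNIV)
  have "Pow (f ` B k) \<approx> f ` B (Suc k)" if "k < n" for k
  proof -
    have "Pow (f ` B k) \<approx> Pow (B k)"
      by (simp add: e eqpoll_Pow_cong)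
    also have "\<dots> \<approx> B (Suc k)"
      using assms(1) that by (simp add: beth_chain_def)
    also have "\<dots> \<approx> f ` B (Suc k)"
      by (simp add: e eqpoll_sym)
    finally show ?thesis .
  qed
  moreover have "infinite (f ` B 0)"
    using assms e by (metis beth_chain_def eqpoll_finite_iff)
  ultimately show ?thesis
    by (simp add: beth_chain_def)
qed

text \<open>Singletons copy the old levels into the next powerset type, where
  \<open>Pow (B n)\<close> itself serves as the new top level.\<close>

lemma beth_chain_Suc:
  fixes B :: "nat \<Rightarrow> 'a set"
  assumes "beth_chain n B"
  shows "\<exists>B' :: nat \<Rightarrow> 'a set set. beth_chain (Suc n) B'"
proof -
  define C :: "nat \<Rightarrow> 'a set set" where "C k = (\<lambda>x. {x}) ` B k" for k
  have C: "beth_chain n C"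
    unfolding C_def by (rule beth_chain_image[OF assms]) simp
  have "Pow (C n) \<approx> Pow (B n)"
    unfolding C_def by (intro eqpoll_Pow_cong inj_on_image_eqpoll_self) simp
  then have "beth_chain (Suc n) (C(Suc n := Pow (B n)))"
    using C by (auto simp: beth_chain_def less_Suc_eq)
  then show ?thesis
    by blast
qed

lemma ex_beth_chain_5:
  fixes j :: "nat set set set set set \<Rightarrow> 'u"
  assumes "inj j"
  shows "\<exists>B :: nat \<Rightarrow> 'u set. beth_chain 5 B"
proof -
  have "beth_chain 0 (\<lambda>_. UNIV :: nat set)"
    by (simp add: beth_chain_def)
  \<comment> \<open>Each further level costs one \<open>set\<close> constructor, which explains the
    five of them in the domain of \<open>j\<close>.\<close>
  then have "\<exists>B :: nat \<Rightarrow> nat set set set set set set. beth_chain (Suc (Suc (Suc (Suc (Suc 0))))) B"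
    by (metis beth_chain_Suc)
  then show ?thesis
    using beth_chain_image[OF _ assms] by (auto simp: eval_nat_numeral)
qed

section \<open>The full structure up to a bounded rank\<close>

instance ty :: countable
  by countable_datatype

text \<open>One fixed choice per set makes \<open>carrier\<close>, \<open>app\<close> and
  \<open>elts\<close> refer to the same code. If no injection exists, the value is
  arbitrary.\<close>

definition some_inj :: "'a set \<Rightarrow> 'a \<Rightarrow> 'b" where
  "some_inj X = (SOME e. inj_on e X)"

lemma inj_on_some_inj:
  assumes "X \<lesssim> (Y :: 'b set)"
  shows "inj_on (some_inj X :: 'a \<Rightarrow> 'b) X"
  using assms unfolding some_inj_def lepoll_def by (metis (mono_tags) someI_ex)

text \<open>Codes carry their type, because \<open>app\<close> and \<open>elts\<close> have to recover the function space
  or the set of finite subsets from the code alone.\<close>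

definition tag :: "ty \<times> 'u \<Rightarrow> 'u" where
  "tag = some_inj UNIV"

definition code :: "ty \<Rightarrow> 'a set \<Rightarrow> 'a \<Rightarrow> 'u" where
  "code \<tau> X x = tag (\<tau>, some_inj X x)"

text \<open>The recursion covers all types, although \<open>'u\<close> may be too small for some of
  them; the codes are shown to be injective only below a bound on the rank.\<close>

fun carrier :: "ty \<Rightarrow> 'u set" where
  "carrier Nat = code Nat UNIV ` (UNIV :: nat set)"
| "carrier Bool = code Bool UNIV ` (UNIV :: bool set)"
| "carrier (\<rho> \<rightarrow>\<^sub>t \<sigma>) = (let X = carrier \<rho> \<rightarrow>\<^sub>E carrier \<sigma> :: ('u \<Rightarrow> 'u) set in code (\<rho> \<rightarrow>\<^sub>t \<sigma>) X ` X)"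
| "carrier (Star \<sigma>) = (let X = {X :: 'u set. X \<subseteq> carrier \<sigma> \<and> finite X \<and> X \<noteq> {}} in code (Star \<sigma>) X ` X)"

definition full_struct :: "'u struct" where
  "full_struct = \<lparr>car = carrier, natv = code Nat UNIV, boolv = code Bool UNIV,
     app = (\<lambda>u. case fst (inv tag u) of
        \<rho> \<rightarrow>\<^sub>t \<sigma> \<Rightarrow> let X = carrier \<rho> \<rightarrow>\<^sub>E carrier \<sigma> in inv_into X (code (\<rho> \<rightarrow>\<^sub>t \<sigma>) X) u),
     elts = (\<lambda>u. case fst (inv tag u) of
        Star \<sigma> \<Rightarrow> let X = {X. X \<subseteq> carrier \<sigma> \<and> finite X \<and> X \<noteq> {}} in inv_into X (code (Star \<sigma>) X) u)\<rparr>"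

text \<open>A full set-theoretic type of rank \<open>k\<close> has at most the cardinality \<open>beth\<^sub>k\<close>.
  In a function type only the domain raises the rank: since a function into a power set is
  a relation, a range that is one step larger costs nothing.\<close>

fun rank :: "ty \<Rightarrow> nat" where
  "rank Nat = 0"
| "rank Bool = 0"
| "rank (\<rho> \<rightarrow>\<^sub>t \<sigma>) = max (Suc (rank \<rho>)) (rank \<sigma>)"
| "rank (Star \<sigma>) = Suc (rank \<sigma>)"

section \<open>Cardinal bounds and standardness up to rank \<open>n\<close>\<close>

context
  fixes B :: "nat \<Rightarrow> 'u set" and n :: nat
  assumes chain: "beth_chain n B"
begin

text \<open>There are only countably many types, and \<open>'u\<close> is infinite because it
  contains \<open>B 0\<close>, so pairing with a type does not enlarge it.\<close>

lemma inj_tag: "inj (tag :: ty \<times> 'u \<Rightarrow> 'u)"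
proof -
  have inf: "infinite (UNIV :: 'u set)"
    using chain unfolding beth_chain_def by (meson finite_subset subset_UNIV)
  have "(UNIV :: ty set) \<lesssim> (UNIV :: nat set)"
    by (metis inj_to_nat lepoll_def subset_UNIV)
  then have "(UNIV :: ty set) \<lesssim> (UNIV :: 'u set)"
    using inf infinite_le_lepoll lepoll_trans by blast
  then have "(UNIV :: ty set) \<times> (UNIV :: 'u set) \<lesssim> (UNIV :: 'u set)"
    by (rule times_lepoll_infinite[OF inf _ lepoll_refl])
  then show ?thesis
    unfolding tag_def UNIV_Times_UNIV by (rule inj_on_some_inj)
qed

lemma fst_inv_tag_code [simp]: "fst (inv tag (code \<tau> X x :: 'u)) = \<tau>"
  by (simp add: code_def inj_tag)

lemma inj_on_code:
  assumes "X \<lesssim> (Y :: 'u set)"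
  shows "inj_on (code \<tau> X :: _ \<Rightarrow> 'u) X"
  using inj_on_some_inj[OF assms] inj_tag unfolding code_def inj_on_def by blast

lemma bij_betw_code:
  assumes "X \<lesssim> (Y :: 'u set)"
  shows "bij_betw (code \<tau> X :: _ \<Rightarrow> 'u) X (code \<tau> X ` X)"
  using inj_on_code[OF assms] by (simp add: bij_betw_def)

lemma funcset_lepoll_chain:
  assumes "X \<lesssim> B i" "Y \<lesssim> B k" "max (Suc i) k \<le> n"
  shows "(X \<rightarrow>\<^sub>E Y) \<lesssim> B (max (Suc i) k)"
proof -
  \<comment> \<open>The maximum is a successor. Its predecessor \<open>p\<close> bounds the level of
    the domain, while the range may lie one level higher, inside \<open>Pow (B p)\<close>.\<close>
  obtain p where p: "max (Suc i) k = Suc p"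
    by (cases "max (Suc i) k") auto
  then have le: "i \<le> p" "k \<le> Suc p" "p < n"
    using assms(3) by auto
  have Pow: "Pow (B p) \<approx> B (Suc p)"
    using chain le by (simp add: beth_chain_def)
  have "Y \<lesssim> Pow (B p)"
    using lepoll_trans[OF assms(2) lepoll_trans2[OF beth_chain_mono[OF chain] eqpoll_sym[OF Pow]]] le
    by simp
  then have "(X \<rightarrow>\<^sub>E Y) \<lesssim> Pow (X \<times> B p)"
    by (rule funcset_lepoll_Pow_Times)
  also have "\<dots> \<lesssim> Pow (B p)"
  proof (intro lepoll_Pow_mono times_lepoll_infinite)
    show "infinite (B p)"
      using beth_chain_infinite[OF chain] le by simp
    show "X \<lesssim> B p"
      using lepoll_trans[OF assms(1) beth_chain_mono[OF chain]] le by simp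
  qed simp
  finally show ?thesis
    using lepoll_trans2[OF _ Pow] p by simp
qed

lemma finite_subsets_lepoll_chain:
  assumes "X \<lesssim> B i" "Suc i \<le> n"
  shows "{Y. Y \<subseteq> X \<and> finite Y \<and> Y \<noteq> {}} \<lesssim> B (Suc i)"
proof -
  have "{Y. Y \<subseteq> X \<and> finite Y \<and> Y \<noteq> {}} \<lesssim> Pow X"
    by (auto intro: subset_imp_lepoll)
  also have "\<dots> \<lesssim> Pow (B i)"
    using assms(1) by (rule lepoll_Pow_mono)
  also have "\<dots> \<approx> B (Suc i)"
    using chain assms(2) by (simp add: beth_chain_def)
  finally show ?thesis .
qed

lemma countable_lepoll_chain: "X \<lesssim> (UNIV :: nat set) \<Longrightarrow> X \<lesssim> B 0"
  using chain lepoll_trans[of X "UNIV :: nat set" "B 0"]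
  by (simp add: beth_chain_def infinite_le_lepoll)

lemma bool_lepoll_chain: "(UNIV :: bool set) \<lesssim> B 0"
  using chain unfolding beth_chain_def by (simp add: finite_lepoll_infinite)

text \<open>Coding takes an image and so never enlarges a set. The sizes can thus be bounded first,
  and the bounds then yield injectivity of the codes.\<close>

lemma carrier_lepoll: "rank \<tau> \<le> n \<Longrightarrow> (carrier \<tau> :: 'u set) \<lesssim> B (rank \<tau>)"
proof (induction \<tau>)
  case Nat
  then show ?case
    by (simp add: countable_lepoll_chain image_lepoll)
next
  case Bool
  then show ?case
    using lepoll_trans[OF image_lepoll bool_lepoll_chain] by simp
next
  case (Fun \<rho> \<sigma>)
  then have "(carrier \<rho> \<rightarrow>\<^sub>E carrier \<sigma> :: ('u \<Rightarrow> 'u) set) \<lesssim> B (rank (\<rho> \<rightarrow>\<^sub>t \<sigma>))"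
    by (simp add: funcset_lepoll_chain)
  from lepoll_trans[OF image_lepoll this] show ?case
    by (simp only: carrier.simps Let_def)
next
  case (Star \<sigma>)
  then have "{X :: 'u set. X \<subseteq> carrier \<sigma> \<and> finite X \<and> X \<noteq> {}} \<lesssim> B (rank (Star \<sigma>))"
    by (simp add: finite_subsets_lepoll_chain)
  from lepoll_trans[OF image_lepoll this] show ?case
    by (simp only: carrier.simps Let_def)
qed

lemma standard_at_full_struct: "rank \<tau> \<le> n \<Longrightarrow> standard_at (full_struct :: 'u struct) \<tau>"
proof (induction \<tau>)
  case Nat
  show ?case
    using bij_betw_code[OF countable_lepoll_chain[OF lepoll_refl]] by (simp add: full_struct_def)
next
  case Bool
  show ?case
    using bij_betw_code[OF bool_lepoll_chain] by (simp add: full_struct_def)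
next
  case (Fun \<rho> \<sigma>)
  let ?X = "carrier \<rho> \<rightarrow>\<^sub>E carrier \<sigma> :: ('u \<Rightarrow> 'u) set" and ?\<tau> = "\<rho> \<rightarrow>\<^sub>t \<sigma>"
  have "?X \<lesssim> B (rank ?\<tau>)"
    using Fun.prems by (simp add: funcset_lepoll_chain carrier_lepoll)
  from bij_betw_inv_into[OF bij_betw_code[OF this, of ?\<tau>]]
  have "bij_betw (inv_into ?X (code ?\<tau> ?X)) (carrier ?\<tau> :: 'u set) ?X"
    by (simp only: carrier.simps Let_def)
  \<comment> \<open>The type tag selects the function space in which to decode. Decoded functions
    are already extensional, so the restriction leaves them unchanged.\<close>
  moreover have "restrict (app full_struct u) (carrier \<rho>) = inv_into ?X (code ?\<tau> ?X) u"
    if u: "u \<in> carrier ?\<tau>" for u :: 'u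
  proof -
    have "fst (inv tag u) = ?\<tau>"
      using u by (auto simp: Let_def)
    moreover have "inv_into ?X (code ?\<tau> ?X) u \<in> ?X"
      using u by (intro inv_into_into) (simp only: carrier.simps Let_def)
    ultimately show ?thesis
      by (simp add: full_struct_def Let_def PiE_restrict)
  qed
  ultimately have "bij_betw (\<lambda>u. restrict (app full_struct u) (carrier \<rho>)) (carrier ?\<tau> :: 'u set) ?X"
    by (simp del: carrier.simps cong: bij_betw_cong)
  then show ?case
    using Fun by (simp add: full_struct_def)
next
  case (Star \<sigma>)
  let ?X = "{X :: 'u set. X \<subseteq> carrier \<sigma> \<and> finite X \<and> X \<noteq> {}}" and ?\<tau> = "Star \<sigma>"
  have "?X \<lesssim> B (rank ?\<tau>)"
    using Star.prems by (simp add: finite_subsets_lepoll_chain carrier_lepoll)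
  from bij_betw_inv_into[OF bij_betw_code[OF this, of ?\<tau>]]
  have "bij_betw (inv_into ?X (code ?\<tau> ?X)) (carrier ?\<tau> :: 'u set) ?X"
    by (simp only: carrier.simps Let_def)
  moreover have "elts full_struct u = inv_into ?X (code ?\<tau> ?X) u" if "u \<in> carrier ?\<tau>" for u :: 'u
    using that by (auto simp: Let_def full_struct_def)
  ultimately have "bij_betw (elts full_struct) (carrier ?\<tau> :: 'u set) ?X"
    by (simp del: carrier.simps cong: bij_betw_cong)
  then show ?case
    using Star by (simp add: full_struct_def)
qed

end

section \<open>Evaluation in standard structures\<close>

lemma app_in_car:
  assumes "standard_at M (\<rho> \<rightarrow>\<^sub>t \<sigma>)" "f \<in> car M (\<rho> \<rightarrow>\<^sub>t \<sigma>)" "x \<in> car M \<rho>"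
  shows "app M f x \<in> car M \<sigma>"
proof -
  have "restrict (app M f) (car M \<rho>) \<in> car M \<rho> \<rightarrow>\<^sub>E car M \<sigma>"
    using assms(1,2) by (metis bij_betwE standard_at.simps(3))
  then show ?thesis
    using assms(3) by (metis PiE_mem restrict_apply')
qed

text \<open>Fullness of the function type: every function between the carriers has a code, and
  \<open>lam\<close> returns it.\<close>

lemma
  assumes "standard_at M (\<rho> \<rightarrow>\<^sub>t \<sigma>)" "\<And>x. x \<in> car M \<rho> \<Longrightarrow> f x \<in> car M \<sigma>"
  shows lam_in_car: "lam M \<rho> \<sigma> f \<in> car M (\<rho> \<rightarrow>\<^sub>t \<sigma>)"
    and app_lam: "x \<in> car M \<rho> \<Longrightarrow> app M (lam M \<rho> \<sigma> f) x = f x"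
proof -
  let ?d = "\<lambda>f. restrict (app M f) (car M \<rho>)"
  have bij: "bij_betw ?d (car M (\<rho> \<rightarrow>\<^sub>t \<sigma>)) (car M \<rho> \<rightarrow>\<^sub>E car M \<sigma>)"
    using assms(1) by simp
  have f: "restrict f (car M \<rho>) \<in> car M \<rho> \<rightarrow>\<^sub>E car M \<sigma>"
    using assms(2) by simp
  show "lam M \<rho> \<sigma> f \<in> car M (\<rho> \<rightarrow>\<^sub>t \<sigma>)"
    unfolding lam_def using bij f by (metis bij_betw_def order_refl the_inv_into_into)
  have "?d (lam M \<rho> \<sigma> f) = restrict f (car M \<rho>)"
    unfolding lam_def using bij f by (rule f_the_inv_into_f_bij_betw)
  then show "app M (lam M \<rho> \<sigma> f) x = f x" if "x \<in> car M \<rho>"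
    using that by (metis restrict_apply')
qed

declare standard_at.simps(3)[simp del]

lemma standard_at_FunD:
  assumes "standard_at M (\<rho> \<rightarrow>\<^sub>t \<sigma>)"
  shows "standard_at M \<rho>" "standard_at M \<sigma>"
  using assms by (simp_all add: standard_at.simps(3))

lemma
  assumes "standard_at M (cty (KC \<rho> \<sigma>))"
  shows den_KC_in_car: "den M (KC \<rho> \<sigma>) \<in> car M (cty (KC \<rho> \<sigma>))"
    and app_den_KC: "x \<in> car M \<rho> \<Longrightarrow> y \<in> car M \<sigma> \<Longrightarrow> app M (app M (den M (KC \<rho> \<sigma>)) x) y = x"
  using assms standard_at_FunD(2)[OF assms[unfolded cty.simps]] by (simp_all add: lam_in_car app_lam)

lemma
  assumes "standard_at M (cty (SC \<rho> \<sigma> \<tau>))"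
  shows den_SC_in_car: "den M (SC \<rho> \<sigma> \<tau>) \<in> car M (cty (SC \<rho> \<sigma> \<tau>))"
    and app_den_SC: "x \<in> car M (\<rho> \<rightarrow>\<^sub>t \<sigma> \<rightarrow>\<^sub>t \<tau>) \<Longrightarrow> y \<in> car M (\<rho> \<rightarrow>\<^sub>t \<sigma>) \<Longrightarrow> z \<in> car M \<rho> \<Longrightarrow>
      app M (app M (app M (den M (SC \<rho> \<sigma> \<tau>)) x) y) z = app M (app M x z) (app M y z)"
proof -
  note std [simp] = assms[unfolded cty.simps] standard_at_FunD[OF assms[unfolded cty.simps]]
  note [simp] = standard_at_FunD[OF std(2)] standard_at_FunD[OF std(3)]
  note [simp] = standard_at_FunD[OF standard_at_FunD(2)[OF std(2)]] standard_at_FunD[OF standard_at_FunD(2)[OF std(3)]]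
  \<comment> \<open>The innermost body has to stay in the carrier before \<open>lam\<close> can be
    evaluated.\<close>
  have S [simp]: "app M (app M x z) (app M y z) \<in> car M \<tau>"
    if "x \<in> car M (\<rho> \<rightarrow>\<^sub>t \<sigma> \<rightarrow>\<^sub>t \<tau>)" "y \<in> car M (\<rho> \<rightarrow>\<^sub>t \<sigma>)" "z \<in> car M \<rho>" for x y z
    using that app_in_car[of M \<rho> "\<sigma> \<rightarrow>\<^sub>t \<tau>" x z] app_in_car[of M \<rho> \<sigma> y z]
    by (intro app_in_car[of M \<sigma> \<tau>]) simp_all
  show "den M (SC \<rho> \<sigma> \<tau>) \<in> car M (cty (SC \<rho> \<sigma> \<tau>))"
    by (simp add: lam_in_car)
  show "app M (app M (app M (den M (SC \<rho> \<sigma> \<tau>)) x) y) z = app M (app M x z) (app M y z)"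
    if "x \<in> car M (\<rho> \<rightarrow>\<^sub>t \<sigma> \<rightarrow>\<^sub>t \<tau>)" "y \<in> car M (\<rho> \<rightarrow>\<^sub>t \<sigma>)" "z \<in> car M \<rho>"
    using that by (simp add: lam_in_car app_lam)
qed

section \<open>Finite sets and membership\<close>

lemma 
  assumes "standard_at M (Star \<sigma>)" "X \<subseteq> car M \<sigma>" "finite X" "X \<noteq> {}"
  shows mkset_in_car: "mkset M \<sigma> X \<in> car M (Star \<sigma>)"
    and elts_mkset: "elts M (mkset M \<sigma> X) = X"
proof -
  have bij: "bij_betw (elts M) (car M (Star \<sigma>)) {X. X \<subseteq> car M \<sigma> \<and> finite X \<and> X \<noteq> {}}"
    using assms(1) by simp
  show "mkset M \<sigma> X \<in> car M (Star \<sigma>)"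
    unfolding mkset_def using bij assms(2-4) by (intro the_inv_into_into) (auto simp: bij_betw_def)
  show "elts M (mkset M \<sigma> X) = X"
    unfolding mkset_def using bij assms(2-4) by (intro f_the_inv_into_f_bij_betw) auto
qed

lemma
  assumes "standard_at M (cty (Sing \<sigma>))"
  shows den_Sing_in_car: "den M (Sing \<sigma>) \<in> car M (cty (Sing \<sigma>))"
    and elts_den_Sing: "x \<in> car M \<sigma> \<Longrightarrow> elts M (app M (den M (Sing \<sigma>)) x) = {x}"
  using assms standard_at_FunD(2)[OF assms[unfolded cty.simps]]
  by (simp_all add: lam_in_car app_lam mkset_in_car elts_mkset del: standard_at.simps(4))

lemma app_den_Mem_eq_True_iff:
  assumes "standard_at M (cty (Mem \<sigma>))" "x \<in> car M \<sigma>" "X \<in> car M (Star \<sigma>)"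
  shows "app M (app M (den M (Mem \<sigma>)) x) X = boolv M True \<longleftrightarrow> x \<in> elts M X"
proof -
  note std [simp] = assms(1)[unfolded cty.simps] standard_at_FunD[OF assms(1)[unfolded cty.simps]]
  have "bij_betw (boolv M) UNIV (car M Bool)"
    using standard_at_FunD(2)[OF std(3)] by simp
  \<comment> \<open>Distinctness of the two truth values turns an equation with
    \<open>boolv M True\<close> back into a membership.\<close>
  then have "inj (boolv M)" "boolv M b \<in> car M Bool" for b
    by (auto simp: bij_betw_def)
  then show ?thesis
    using assms by (simp add: lam_in_car app_lam inj_eq)
qed

text \<open>The combinator \<open>\<lambda>h x y. h x\<close>, in the form \<open>S (K K)\<close>.\<close>

definition weaken :: "ty \<Rightarrow> ty \<Rightarrow> ty \<Rightarrow> trm" where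
  "weaken \<rho> \<sigma> \<tau> = Cst (SC \<rho> \<tau> (\<sigma> \<rightarrow>\<^sub>t \<tau>)) \<cdot> (Cst (KC (\<tau> \<rightarrow>\<^sub>t \<sigma> \<rightarrow>\<^sub>t \<tau>) \<rho>) \<cdot> Cst (KC \<tau> \<sigma>))"

lemma lift_weaken [simp]: "lift d c (weaken \<rho> \<sigma> \<tau>) = weaken \<rho> \<sigma> \<tau>"
  by (simp add: weaken_def)

lemma tyof_weaken [simp]: "tyof \<Gamma> (weaken \<rho> \<sigma> \<tau>) = Some ((\<rho> \<rightarrow>\<^sub>t \<tau>) \<rightarrow>\<^sub>t \<rho> \<rightarrow>\<^sub>t \<sigma> \<rightarrow>\<^sub>t \<tau>)"
  by (simp add: weaken_def)

text \<open>The reduction is \<open>S (K K) h x y = K K x (h x) y = K (h x) y = h x\<close>.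
  Standardness is assumed just at the types of the constants, because a structure for a sentence
  provides it only at types occurring there; component types inherit it.\<close>

lemma
  assumes "\<And>\<tau>'. \<tau>' \<in> types_trm (weaken \<rho> \<sigma> \<tau>) \<Longrightarrow> standard_at M \<tau>'"
  shows eval_weaken_in_car: "eval M e (weaken \<rho> \<sigma> \<tau>) \<in> car M ((\<rho> \<rightarrow>\<^sub>t \<tau>) \<rightarrow>\<^sub>t \<rho> \<rightarrow>\<^sub>t \<sigma> \<rightarrow>\<^sub>t \<tau>)"
    and app_eval_weaken: "h \<in> car M (\<rho> \<rightarrow>\<^sub>t \<tau>) \<Longrightarrow> x \<in> car M \<rho> \<Longrightarrow> y \<in> car M \<sigma> \<Longrightarrow>
      app M (app M (app M (eval M e (weaken \<rho> \<sigma> \<tau>)) h) x) y = app M h x"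
proof -
  have S: "standard_at M (cty (SC \<rho> \<tau> (\<sigma> \<rightarrow>\<^sub>t \<tau>)))"
    and K: "standard_at M (cty (KC (\<tau> \<rightarrow>\<^sub>t \<sigma> \<rightarrow>\<^sub>t \<tau>) \<rho>))" and K': "standard_at M (cty (KC \<tau> \<sigma>))"
    by (simp_all add: assms weaken_def)
  note in_car = den_SC_in_car[OF S, unfolded cty.simps] den_KC_in_car[OF K, unfolded cty.simps]
    den_KC_in_car[OF K', unfolded cty.simps]
  have KK: "app M (den M (KC (\<tau> \<rightarrow>\<^sub>t \<sigma> \<rightarrow>\<^sub>t \<tau>) \<rho>)) (den M (KC \<tau> \<sigma>)) \<in> car M (\<rho> \<rightarrow>\<^sub>t \<tau> \<rightarrow>\<^sub>t \<sigma> \<rightarrow>\<^sub>t \<tau>)"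
    by (rule app_in_car[OF K[unfolded cty.simps] in_car(2,3)])
  show "eval M e (weaken \<rho> \<sigma> \<tau>) \<in> car M ((\<rho> \<rightarrow>\<^sub>t \<tau>) \<rightarrow>\<^sub>t \<rho> \<rightarrow>\<^sub>t \<sigma> \<rightarrow>\<^sub>t \<tau>)"
    unfolding weaken_def eval.simps by (rule app_in_car[OF S[unfolded cty.simps] in_car(1) KK])
  assume "h \<in> car M (\<rho> \<rightarrow>\<^sub>t \<tau>)" "x \<in> car M \<rho>" "y \<in> car M \<sigma>"
  moreover from this have "app M h x \<in> car M \<tau>"
    using app_in_car[OF standard_at_FunD(1)[OF standard_at_FunD(2)[OF S[unfolded cty.simps]]]] by blast
  ultimately show "app M (app M (app M (eval M e (weaken \<rho> \<sigma> \<tau>)) h) x) y = app M h x"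
    by (simp add: weaken_def app_den_SC[OF S] app_den_KC[OF K] app_den_KC[OF K'] KK in_car
       del: den.simps)
qed

section \<open>The realizers\<close>

abbreviation "N1 \<equiv> Nat \<rightarrow>\<^sub>t Nat"

text \<open>The outer \<open>K\<close> discards \<Psi>, and \<open>weaken\<close> lets \<mu> ignore
  the last argument g'.\<close>

definition modulus_term :: trm where
  "modulus_term = Cst (KC ((N1 \<rightarrow>\<^sub>t Star Nat) \<rightarrow>\<^sub>t N1 \<rightarrow>\<^sub>t N1 \<rightarrow>\<^sub>t Star Nat) (N1 \<rightarrow>\<^sub>t Nat)) \<cdot> weaken N1 N1 (Star Nat)"

definition singleton_term :: trm where
  "singleton_term = Cst (KC ((N1 \<rightarrow>\<^sub>t Star Nat) \<rightarrow>\<^sub>t N1 \<rightarrow>\<^sub>t N1 \<rightarrow>\<^sub>t Star N1) (N1 \<rightarrow>\<^sub>t Nat)) \<cdot>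
     (Cst (KC (N1 \<rightarrow>\<^sub>t N1 \<rightarrow>\<^sub>t Star N1) (N1 \<rightarrow>\<^sub>t Star Nat)) \<cdot> (weaken N1 N1 (Star N1) \<cdot> Cst (Sing N1)))"

lemma lift_realizers [simp]:
  "lift d c modulus_term = modulus_term"
  "lift d c singleton_term = singleton_term"
  by (simp_all add: modulus_term_def singleton_term_def)

text \<open>Each implication appends the challenges to its premise at the end, so the innermost
  premise comes first: the order is \<open>f n = g n\<close>, then the predicates for g, f and
  \<Phi>.\<close>

abbreviation ext2_realizers :: "trm list" where
  "ext2_realizers \<equiv> [modulus_term, modulus_term, modulus_term, singleton_term]"

definition ext2_interp :: fm where
  "ext2_interp = foldr All (dn (relativize ext2))
     (interp (relativize ext2) ext2_realizers (vars (length (dn (relativize ext2)))))"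

lemma tyof_realizers:
  "map (tyof []) ext2_realizers = map Some (up (relativize ext2))"
  by (simp add: modulus_term_def singleton_term_def ext2_def Let_def funty_def)

text \<open>Abstracting the realizers to terms fixed by \<open>lift\<close> keeps their combinators
  opaque while the interpretation is computed.\<close>

lemma interp_ext2:
  assumes [simp]: "\<And>d c. lift d c t1 = t1" "\<And>d c. lift d c t2 = t2"
    "\<And>d c. lift d c t3 = t3" "\<And>d c. lift d c t4 = t4"
  defines "mem \<equiv> \<lambda>\<sigma> x X. Eq Bool (Cst (Mem \<sigma>) \<cdot> x \<cdot> X) (Cst TT)"
  shows "foldr All (dn (relativize ext2))
      (interp (relativize ext2) [t1, t2, t3, t4] (vars (length (dn (relativize ext2))))) =
    All (N1 \<rightarrow>\<^sub>t Nat) (All (N1 \<rightarrow>\<^sub>t Star Nat) (All N1 (All N1 (All (N1 \<rightarrow>\<^sub>t Nat) (Imp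
      (All N1 (Imp (mem N1 (Var 0) (t4 \<cdot> Var 5 \<cdot> Var 4 \<cdot> Var 3 \<cdot> Var 2))
        (All N1 (Imp
          (All Nat (Imp (mem Nat (Var 0) (Var 6 \<cdot> Var 2))
            (All Nat (Imp (Eq Nat (Var 0) (Var 1)) (Eq Nat (Var 2 \<cdot> Var 0) (Var 3 \<cdot> Var 1))))))
          (Eq Nat (Var 2 \<cdot> Var 0) (Var 6 \<cdot> Var 1))))))
      (All N1 (Imp
        (All Nat (Imp (mem Nat (Var 0) (t3 \<cdot> Var 6 \<cdot> Var 5 \<cdot> Var 4 \<cdot> Var 3))
          (All Nat (Imp (Eq Nat (Var 0) (Var 1)) (Eq Nat (Var 2 \<cdot> Var 0) (Var 5 \<cdot> Var 1))))))
        (All N1 (Imp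
          (All Nat (Imp (mem Nat (Var 0) (t2 \<cdot> Var 7 \<cdot> Var 6 \<cdot> Var 5 \<cdot> Var 4))
            (All Nat (Imp (Eq Nat (Var 0) (Var 1)) (Eq Nat (Var 2 \<cdot> Var 0) (Var 5 \<cdot> Var 1))))))
          (Imp
            (All Nat (Imp (mem Nat (Var 0) (t1 \<cdot> Var 7 \<cdot> Var 6 \<cdot> Var 5 \<cdot> Var 4))
              (All Nat (Imp (Eq Nat (Var 0) (Var 1)) (Eq Nat (Var 3 \<cdot> Var 0) (Var 2 \<cdot> Var 0))))))
            (Eq Nat (Var 2 \<cdot> Var 1) (Var 2 \<cdot> Var 0))))))))))))"
  by (simp add: ext2_def vars_def apps_def funty_def Let_def mem_def eval_nat_numeral)

lemmas ext2_interp_eq = interp_ext2[OF lift_realizers(1) lift_realizers(1) lift_realizers(1) lift_realizers(2),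
   folded ext2_interp_def]

lemma wf_ext2_interp: "wf_fm [] ext2_interp"
  by (simp add: ext2_interp_eq modulus_term_def singleton_term_def)

lemma rank_types_ext2_interp: "\<tau> \<in> types_fm ext2_interp \<Longrightarrow> rank \<tau> \<le> 5"
  by (auto simp: ext2_interp_eq modulus_term_def singleton_term_def weaken_def)

lemma eval_modulus_term:
  assumes std: "\<And>\<tau>. \<tau> \<in> types_trm modulus_term \<Longrightarrow> standard_at M \<tau>"
    and \<Psi>: "\<Psi> \<in> car M (N1 \<rightarrow>\<^sub>t Nat)" and \<mu>: "\<mu> \<in> car M (N1 \<rightarrow>\<^sub>t Star Nat)"
    and f: "f \<in> car M N1" and g: "g \<in> car M N1"
  shows "app M (app M (app M (app M (eval M e modulus_term) \<Psi>) \<mu>) f) g = app M \<mu> f"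
proof -
  let ?\<tau> = "(N1 \<rightarrow>\<^sub>t Star Nat) \<rightarrow>\<^sub>t N1 \<rightarrow>\<^sub>t N1 \<rightarrow>\<^sub>t Star Nat"
  have K: "standard_at M (cty (KC ?\<tau> (N1 \<rightarrow>\<^sub>t Nat)))"
    by (rule std) (simp add: modulus_term_def)
  have weaken: "standard_at M \<tau>" if "\<tau> \<in> types_trm (weaken N1 N1 (Star Nat))" for \<tau>
    using that by (intro std) (simp add: modulus_term_def)
  show ?thesis
    using app_den_KC[OF K eval_weaken_in_car[OF weaken] \<Psi>] app_eval_weaken[OF weaken \<mu> f g]
    by (simp add: modulus_term_def del: den.simps)
qed

lemma eval_singleton_term:
  assumes std: "\<And>\<tau>. \<tau> \<in> types_trm singleton_term \<Longrightarrow> standard_at M \<tau>"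
    and \<Psi>: "\<Psi> \<in> car M (N1 \<rightarrow>\<^sub>t Nat)" and \<mu>: "\<mu> \<in> car M (N1 \<rightarrow>\<^sub>t Star Nat)"
    and f: "f \<in> car M N1" and g: "g \<in> car M N1"
  shows "app M (app M (app M (app M (eval M e singleton_term) \<Psi>) \<mu>) f) g = app M (den M (Sing N1)) f"
proof -
  let ?\<sigma> = "N1 \<rightarrow>\<^sub>t N1 \<rightarrow>\<^sub>t Star N1"
  let ?\<tau> = "(N1 \<rightarrow>\<^sub>t Star Nat) \<rightarrow>\<^sub>t ?\<sigma>"
  have K: "standard_at M (cty (KC ?\<tau> (N1 \<rightarrow>\<^sub>t Nat)))" and K': "standard_at M (cty (KC ?\<sigma> (N1 \<rightarrow>\<^sub>t Star Nat)))"
    and Sing: "standard_at M (cty (Sing N1))"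
    by (rule std, simp add: singleton_term_def)+
  have weaken: "standard_at M \<tau>" if "\<tau> \<in> types_trm (weaken N1 N1 (Star N1))" for \<tau>
    using that by (intro std) (simp add: singleton_term_def)
  have Sing_in_car: "den M (Sing N1) \<in> car M (N1 \<rightarrow>\<^sub>t Star N1)"
    using den_Sing_in_car[OF Sing] by simp
  have "standard_at M ((N1 \<rightarrow>\<^sub>t Star N1) \<rightarrow>\<^sub>t ?\<sigma>)"
    by (rule standard_at_FunD(2)[of _ "N1 \<rightarrow>\<^sub>t Star N1 \<rightarrow>\<^sub>t N1 \<rightarrow>\<^sub>t Star N1"], rule weaken) (simp add: weaken_def)
  from app_in_car[OF this eval_weaken_in_car[OF weaken] Sing_in_car]
  \<comment> \<open>\<open>K\<close> is known to compute only on carrier elements, so each partial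
    application is first placed in its carrier.\<close>
  have W: "app M (eval M e (weaken N1 N1 (Star N1))) (den M (Sing N1)) \<in> car M ?\<sigma>" .
  have "app M (den M (KC ?\<sigma> (N1 \<rightarrow>\<^sub>t Star Nat))) (app M (eval M e (weaken N1 N1 (Star N1))) (den M (Sing N1))) \<in> car M ?\<tau>"
    using app_in_car[OF K'[unfolded cty.simps] den_KC_in_car[OF K', unfolded cty.simps] W] .
  from app_den_KC[OF K this \<Psi>] app_den_KC[OF K' W \<mu>] app_eval_weaken[OF weaken Sing_in_car f g]
  show ?thesis
    by (simp add: singleton_term_def del: den.simps)
qed

lemma sat_ext2_interp:
  assumes std: "standard (types_fm ext2_interp) M"
  shows "sat M [] ext2_interp"
proof -
  have std_at: "standard_at M \<tau>" if "\<tau> \<in> types_fm ext2_interp" for \<tau>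
    using std that by (simp add: standard_def)
  have mod: "standard_at M \<tau>" if "\<tau> \<in> types_trm modulus_term" for \<tau>
    using that by (intro std_at) (simp add: ext2_interp_eq)
  have sing: "standard_at M \<tau>" if "\<tau> \<in> types_trm singleton_term" for \<tau>
    using that by (intro std_at) (simp add: ext2_interp_eq)
  have Mem_Nat: "standard_at M (cty (Mem Nat))" and Mem_N1: "standard_at M (cty (Mem N1))"
    and \<mu>_std: "standard_at M (N1 \<rightarrow>\<^sub>t Star Nat)"
    by (rule std_at, simp add: ext2_interp_eq)+
  have Sing: "standard_at M (cty (Sing N1))"
    by (rule sing) (simp add: singleton_term_def)
  have TT: "den M TT = boolv M True"
    by simp
  show ?thesis
    unfolding ext2_interp_eq
  proof (simp add: TT del: den.simps, intro ballI impI, goal_cases)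
    case (1 \<Psi> \<mu> f' g' \<Phi> f g)
    note \<Psi> = 1(1) and \<mu> = 1(2) and f' = 1(3) and g' = 1(4) and f = 1(7) and g = 1(9)
    have \<mu>f': "app M \<mu> f' \<in> car M (Star Nat)"
      by (rule app_in_car[OF \<mu>_std \<mu> f'])
    have "app M (den M (Sing N1)) f' \<in> car M (Star N1)"
      using app_in_car[OF _ den_Sing_in_car[OF Sing, unfolded cty.simps] f'] Sing by simp
    from app_den_Mem_eq_True_iff[OF Mem_N1 f' this]
    \<comment> \<open>This discharges the guard of the bounded quantifier in the hypothesis on
      \<Phi>, whose challenge set is the singleton of f'.\<close>
    have f'_mem: "app M (app M (den M (Mem N1)) f') (app M (den M (Sing N1)) f') = boolv M True"
      using elts_den_Sing[OF Sing f'] by simp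
    note [simp] = eval_modulus_term[OF mod \<Psi> \<mu> f' g'] eval_singleton_term[OF sing \<Psi> \<mu> f' g']
      app_den_Mem_eq_True_iff[OF Mem_Nat _ \<mu>f']
    have \<Phi>: "app M \<Phi> h = app M \<Psi> f'"
      if "h \<in> car M N1" "\<And>k. k \<in> car M Nat \<Longrightarrow> k \<in> elts M (app M \<mu> f') \<Longrightarrow> app M h k = app M f' k" for h
      using 1(6) f' f'_mem that by (simp del: den.simps)
    \<comment> \<open>The simplifier has used each finite agreement to rewrite the next one, so \<open>f\<close> and
      \<open>g\<close> are both compared with \<open>g'\<close> in the last two hypotheses.\<close>
    have agree: "app M f k = app M f' k" "app M f k = app M g k"
      if "k \<in> car M Nat" "k \<in> elts M (app M \<mu> f')" for k
      using 1(8,10,11) that by (simp_all del: den.simps)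
    \<comment> \<open>On \<mu> f', g is compared with f' by way of f: g k = f k = f' k.\<close>
    have "app M \<Phi> f = app M \<Psi> f'" "app M \<Phi> g = app M \<Psi> f'"
      using agree by (auto intro!: \<Phi> f g)
    then show ?case
      by simp
  qed
qed

theorem corollary7p7:
  fixes j :: "nat set set set set set \<Rightarrow> 'u"
  assumes "inj j"
  shows "Icp_interpretable TYPE('u) ext2"
proof -
  obtain B :: "nat \<Rightarrow> 'u set" where "beth_chain 5 B"
    using ex_beth_chain_5[OF assms] by blast
  \<comment> \<open>The size of \<open>'u\<close> matters only here, for the existence of a standard
    structure; satisfaction is proved in every structure standard at the types of the
    sentence.\<close>
  then have "standard (types_fm ext2_interp) (full_struct :: 'u struct)"
    by (simp add: standard_def standard_at_full_struct rank_types_ext2_interp)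
  then have "ext2_interp \<in> true_sentences TYPE('u)"
    using wf_ext2_interp sat_ext2_interp by (auto simp: true_sentences_def)
  moreover have "HA_sentence ext2"
    by (simp add: HA_sentence_def ext2_def Let_def)
  ultimately show ?thesis
    unfolding Icp_interpretable_def U_interpretable_def ext2_interp_def
    using tyof_realizers by blast
qed

end
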